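(* Let $\mathbf{F}_q$ be a finite field of characteristic $p$ and let $n$ be a positive integer with $(n,p) \neq (3,3)$ and $(n,p)\neq (4,2)$. Then the Lie algebra $\mathfrak{psl}_n(\mathbf{F}_q)$ is $2$-generated.
   Context: For a field $\mathbf{F}$, $\mathfrak{sl}_n(\mathbf{F})$ is the Lie algebra over $\mathbf{F}$ of traceless $n\times n$ matrices with bracket $[x,y]=xy-yx$, and $\mathfrak{psl}_n(\mathbf{F})$ is its quotient by the central ideal of scalar matrices contained in $\mathfrak{sl}_n(\mathbf{F})$. A Lie algebra over $\mathbf{F}$ is $k$-generated if there are $k$ elements such that the smallest Lie subalgebra over $\mathbf{F}$ (an $\mathbf{F}$-subspace closed under the bracket) containing them is the whole algebra. *)

theory Defs
  imports "Jordan_Normal_Form.VS_Connect" "HOL-Algebra.QuotRing"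
begin

text \<open>A Lie algebra is carried by a module record whose multiplication field holds the bracket;
  the field for the multiplicative unit plays no role.\<close>

locale lie_algebra = vectorspace K L for K and L (structure) +
  assumes bracket_closed: "\<lbrakk>x \<in> carrier L; y \<in> carrier L\<rbrakk> \<Longrightarrow> x \<otimes> y \<in> carrier L"
    and bracket_add_left: "\<lbrakk>x \<in> carrier L; y \<in> carrier L; z \<in> carrier L\<rbrakk>
      \<Longrightarrow> (x \<oplus> y) \<otimes> z = x \<otimes> z \<oplus> y \<otimes> z"
    and bracket_add_right: "\<lbrakk>x \<in> carrier L; y \<in> carrier L; z \<in> carrier L\<rbrakk>
      \<Longrightarrow> z \<otimes> (x \<oplus> y) = z \<otimes> x \<oplus> z \<otimes> y"
    and bracket_smult_left: "\<lbrakk>a \<in> carrier K; x \<in> carrier L; y \<in> carrier L\<rbrakk>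
      \<Longrightarrow> (a \<odot> x) \<otimes> y = a \<odot> (x \<otimes> y)"
    and bracket_smult_right: "\<lbrakk>a \<in> carrier K; x \<in> carrier L; y \<in> carrier L\<rbrakk>
      \<Longrightarrow> x \<otimes> (a \<odot> y) = a \<odot> (x \<otimes> y)"
    and bracket_self: "x \<in> carrier L \<Longrightarrow> x \<otimes> x = \<zero>"
    and jacobi: "\<lbrakk>x \<in> carrier L; y \<in> carrier L; z \<in> carrier L\<rbrakk>
      \<Longrightarrow> x \<otimes> (y \<otimes> z) \<oplus> y \<otimes> (z \<otimes> x) \<oplus> z \<otimes> (x \<otimes> y) = \<zero>"

definition lie_subalgebra :: "('k, 'r) ring_scheme \<Rightarrow> 'v set \<Rightarrow> ('k, 'v, 'm) module_scheme \<Rightarrow> bool"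
  where "lie_subalgebra K S L \<longleftrightarrow>
    subspace K S L \<and> (\<forall>x \<in> S. \<forall>y \<in> S. x \<otimes>\<^bsub>L\<^esub> y \<in> S)"

definition lie_ideal :: "('k, 'r) ring_scheme \<Rightarrow> 'v set \<Rightarrow> ('k, 'v, 'm) module_scheme \<Rightarrow> bool"
  where "lie_ideal K I L \<longleftrightarrow>
    subspace K I L \<and> (\<forall>x \<in> carrier L. \<forall>y \<in> I. x \<otimes>\<^bsub>L\<^esub> y \<in> I \<and> y \<otimes>\<^bsub>L\<^esub> x \<in> I)"

definition lie_generated :: "('k, 'r) ring_scheme \<Rightarrow> ('k, 'v, 'm) module_scheme \<Rightarrow> 'v set \<Rightarrow> 'v set"
  where "lie_generated K L X = \<Inter> {S. lie_subalgebra K S L \<and> X \<subseteq> S}"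

text \<open>The generators form a list, so they need not be distinct.\<close>

definition k_generated :: "nat \<Rightarrow> ('k, 'r) ring_scheme \<Rightarrow> ('k, 'v, 'm) module_scheme \<Rightarrow> bool"
  where "k_generated k K L \<longleftrightarrow>
    (\<exists>xs. length xs = k \<and> set xs \<subseteq> carrier L \<and> lie_generated K L (set xs) = carrier L)"

definition lie_quotient :: "('k, 'v, 'm) module_scheme \<Rightarrow> 'v set \<Rightarrow> ('k, 'v set) module"
  where "lie_quotient L I =
    \<lparr>carrier = a_rcosets\<^bsub>L\<^esub> I, mult = rcoset_mult L I, one = a_r_coset L I \<one>\<^bsub>L\<^esub>,
     zero = I, add = set_add L, smult = (\<lambda>a X. \<Union>x \<in> X. a_r_coset L I (a \<odot>\<^bsub>L\<^esub> x))\<rparr>"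

lemma lie_quotient_simps:
  "carrier (lie_quotient L I) = a_rcosets\<^bsub>L\<^esub> I"
  "mult (lie_quotient L I) = rcoset_mult L I"
  "zero (lie_quotient L I) = I"
  "add (lie_quotient L I) = set_add L"
  "smult (lie_quotient L I) = (\<lambda>a X. \<Union>x \<in> X. a_r_coset L I (a \<odot>\<^bsub>L\<^esub> x))"
  by (simp_all add: lie_quotient_def)

context lie_algebra
begin

lemma lie_ideal_abelian_subgroup:
  assumes "lie_ideal K I L"
  shows "abelian_subgroup I L"
proof -
  have sub: "submodule K I L"
    using assms by (simp add: lie_ideal_def subspace_def)
  have "\<ominus> x \<in> I" if "x \<in> I" for x
  proof -
    have x: "x \<in> carrier L"
      using submodule.subset[OF sub] that by blast
    have "\<ominus> x = (\<ominus>\<^bsub>K\<^esub> \<one>\<^bsub>K\<^esub>) \<odot> x"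
      using smult_minus_1[OF x] by simp
    then show ?thesis
      using submodule.smult_closed[OF sub _ that] by simp
  qed
  then have "subgroup I (add_monoid L)"
    using submodule.subset[OF sub] submodule.m_closed[OF sub] submodule.zero_closed[OF sub]
    by (intro subgroup.intro) (auto simp: a_inv_def)
  then show ?thesis
    by (intro abelian_subgroupI3 additive_subgroup.intro M.abelian_group_axioms)
qed

lemma lie_ideal_quotient:
  assumes ideal: "lie_ideal K I L"
  shows "lie_algebra K (lie_quotient L I)"
proof -
  interpret I: abelian_subgroup I L
    by (rule lie_ideal_abelian_subgroup[OF ideal])
  have sub: "submodule K I L"
    using ideal by (simp add: lie_ideal_def subspace_def)
  have I_smult: "a \<odot> h \<in> I" if "a \<in> carrier K" "h \<in> I" for a h
    using submodule.smult_closed[OF sub] that by blast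
  have I_left: "x \<otimes> h \<in> I" and I_right: "h \<otimes> x \<in> I" if "x \<in> carrier L" "h \<in> I" for x h
    using ideal that by (auto simp: lie_ideal_def)
  have sub_carrier: "h \<in> carrier L" if "h \<in> I" for h
    using submodule.subset[OF sub] that by blast
  let ?c = "\<lambda>x. I +> x"
  let ?Q = "lie_quotient L I"
  have carrier_iff: "X \<in> carrier ?Q \<longleftrightarrow> (\<exists>x \<in> carrier L. X = ?c x)" for X
    by (auto simp: lie_quotient_simps A_RCOSETS_def')
  have in_coset: "?c (h \<oplus> x) = ?c x" if "h \<in> I" "x \<in> carrier L" for h x
  proof -
    have "h \<oplus> x \<in> ?c x"
      using that by (auto simp: a_r_coset_def')
    then show ?thesis
      using a_repr_independence[OF _ that(2) I.a_subgroup] by simp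
  qed
  have elem: "\<exists>h \<in> I. y = h \<oplus> x" if "y \<in> ?c x" for x y
    using that by (auto simp: a_r_coset_def')
  have self: "x \<in> ?c x" if "x \<in> carrier L" for x
    using that by (rule I.a_rcos_self)
  have add: "?c x \<oplus>\<^bsub>?Q\<^esub> ?c y = ?c (x \<oplus> y)" if "x \<in> carrier L" "y \<in> carrier L" for x y
    using I.a_rcos_sum that by (simp add: lie_quotient_simps)
  have zero: "\<zero>\<^bsub>?Q\<^esub> = ?c \<zero>"
    using a_coset_join2[OF zero_closed I.a_subgroup] I.zero_closed by (simp add: lie_quotient_simps)
  have smult: "a \<odot>\<^bsub>?Q\<^esub> ?c x = ?c (a \<odot> x)" if a: "a \<in> carrier K" and x: "x \<in> carrier L" for a x
  proof -
    have "?c (a \<odot> y) = ?c (a \<odot> x)" if "y \<in> ?c x" for y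
    proof -
      obtain h where h: "h \<in> I" "y = h \<oplus> x"
        using elem[OF \<open>y \<in> ?c x\<close>] by blast
      then have "a \<odot> y = a \<odot> h \<oplus> a \<odot> x"
        using a x sub_carrier by (simp add: smult_r_distr)
      then show ?thesis
        using in_coset[OF I_smult[OF a h(1)], of "a \<odot> x"] a x by simp
    qed
    then show ?thesis
      using self[OF x] unfolding lie_quotient_simps by blast
  qed
  have bracket: "?c x \<otimes>\<^bsub>?Q\<^esub> ?c y = ?c (x \<otimes> y)"
    if x: "x \<in> carrier L" and y: "y \<in> carrier L" for x y
  proof -
    have "?c (v \<otimes> w) = ?c (x \<otimes> y)" if v: "v \<in> ?c x" and w: "w \<in> ?c y" for v w
    proof -
      obtain h k where h: "h \<in> I" "v = h \<oplus> x" and k: "k \<in> I" "w = k \<oplus> y"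
        using elem[OF v] elem[OF w] by blast
      have hk: "h \<in> carrier L" "k \<in> carrier L"
        using h k sub_carrier by auto
      have "v \<otimes> w = (h \<otimes> k \<oplus> x \<otimes> k) \<oplus> h \<otimes> y \<oplus> x \<otimes> y"
        using hk x y
        by (simp add: h k bracket_add_left bracket_add_right bracket_closed M.add.m_assoc)
      moreover have "(h \<otimes> k \<oplus> x \<otimes> k) \<oplus> h \<otimes> y \<in> I"
        using h k x y hk by (intro I.a_closed I_left I_right)
      ultimately show ?thesis
        using in_coset bracket_closed x y by simp
    qed
    then show ?thesis
      using self[OF x] self[OF y] unfolding lie_quotient_simps rcoset_mult_def by blast
  qed
  have vs: "vectorspace K ?Q"
  proof (intro vectorspace.intro module_criteria)
    show "\<forall>v \<in> carrier ?Q. \<exists>neg_v \<in> carrier ?Q. v \<oplus>\<^bsub>?Q\<^esub> neg_v = \<zero>\<^bsub>?Q\<^esub>"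
    proof
      fix v assume "v \<in> carrier ?Q"
      then obtain x where x: "x \<in> carrier L" "v = ?c x"
        by (auto simp: carrier_iff)
      then have "?c (\<ominus> x) \<in> carrier ?Q" "v \<oplus>\<^bsub>?Q\<^esub> ?c (\<ominus> x) = \<zero>\<^bsub>?Q\<^esub>"
        by (auto simp: carrier_iff add zero r_neg)
      then show "\<exists>neg_v \<in> carrier ?Q. v \<oplus>\<^bsub>?Q\<^esub> neg_v = \<zero>\<^bsub>?Q\<^esub>"
        by blast
    qed
  qed (auto simp: carrier_iff add zero smult M.add.m_ac smult_l_distr smult_r_distr smult_assoc1,
       (unfold_locales)?)
  show ?thesis
  proof (intro lie_algebra.intro lie_algebra_axioms.intro vs)
  qed (auto simp: carrier_iff add zero smult bracket bracket_closed bracket_add_left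
      bracket_add_right bracket_smult_left bracket_smult_right bracket_self jacobi)
qed

end

definition mat_trace :: "'a::comm_monoid_add mat \<Rightarrow> 'a"
  where "mat_trace A = (\<Sum>i<dim_row A. A $$ (i, i))"

definition sl :: "'a::field itself \<Rightarrow> nat \<Rightarrow> ('a, 'a mat) module"
  where "sl ty n = (module_mat ty n n)
    \<lparr>carrier := {A \<in> carrier_mat n n. mat_trace A = 0}, mult := (\<lambda>A B. A * B - B * A)\<rparr>"

definition scalar_mats :: "'a::field itself \<Rightarrow> nat \<Rightarrow> 'a mat set"
  where "scalar_mats ty n = range (\<lambda>c. c \<cdot>\<^sub>m 1\<^sub>m n)"

definition psl :: "'a::field itself \<Rightarrow> nat \<Rightarrow> ('a, 'a mat set) module"
  where "psl ty n = lie_quotient (sl ty n) (scalar_mats ty n \<inter> carrier (sl ty n))"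

lemmas sl_simps = sl_def module_mat_def

lemma mat_trace_mult_comm:
  fixes A B :: "'a::comm_semiring_0 mat"
  assumes "A \<in> carrier_mat n n" "B \<in> carrier_mat n n"
  shows "mat_trace (A * B) = mat_trace (B * A)"
proof -
  have "mat_trace (A * B) = (\<Sum>i<n. \<Sum>j<n. A $$ (i, j) * B $$ (j, i))"
    using assms by (auto simp: mat_trace_def scalar_prod_def atLeast0LessThan intro!: sum.cong)
  also have "\<dots> = (\<Sum>j<n. \<Sum>i<n. B $$ (j, i) * A $$ (i, j))"
    by (subst sum.swap) (simp add: mult.commute)
  also have "\<dots> = mat_trace (B * A)"
    using assms by (auto simp: mat_trace_def scalar_prod_def atLeast0LessThan intro!: sum.cong)
  finally show ?thesis .
qed

lemma mat_trace_simps: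
  assumes "A \<in> carrier_mat n n" "B \<in> carrier_mat n n"
  shows "mat_trace (A + B) = mat_trace A + mat_trace (B :: 'a::field mat)"
    "mat_trace (A - B) = mat_trace A - mat_trace B"
    "mat_trace (c \<cdot>\<^sub>m A) = c * mat_trace A"
  using assms by (auto simp: mat_trace_def sum.distrib sum_subtractf sum_distrib_left)

lemma mat_trace_zero: "mat_trace (0\<^sub>m n n) = 0"
  by (simp add: mat_trace_def)

lemma vectorspace_sl: "vectorspace class_ring (sl TYPE('a::field) n)"
proof (intro vectorspace.intro module_criteria)
  show "cring (class_ring :: 'a ring)"
    by (rule class_cring.cring_axioms)
  show "field (class_ring :: 'a ring)"
    by (rule class_field)
  let ?L = "sl TYPE('a) n"
  show "\<forall>v \<in> carrier ?L. \<exists>w \<in> carrier ?L. v \<oplus>\<^bsub>?L\<^esub> w = \<zero>\<^bsub>?L\<^esub>"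
  proof
    fix v assume "v \<in> carrier ?L"
    then show "\<exists>w \<in> carrier ?L. v \<oplus>\<^bsub>?L\<^esub> w = \<zero>\<^bsub>?L\<^esub>"
      by (intro bexI[of _ "(- 1) \<cdot>\<^sub>m v"]) (auto simp: sl_simps mat_trace_simps)
  qed
qed (auto simp: sl_simps mat_trace_simps mat_trace_zero comm_add_mat[of _ n n] assoc_add_mat[of _ n n]
    add_smult_distrib_left_mat[of _ n n] add_smult_distrib_right_mat algebra_simps intro!: eq_matI)

lemma lie_algebra_sl: "lie_algebra class_ring (sl TYPE('a::field) n)"
proof (intro lie_algebra.intro lie_algebra_axioms.intro vectorspace_sl)
  let ?L = "sl TYPE('a) n"
  fix x y z :: "'a mat" and a :: 'a
  assume xyz: "x \<in> carrier ?L" "y \<in> carrier ?L"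
  then have c: "x \<in> carrier_mat n n" "y \<in> carrier_mat n n"
    by (simp_all add: sl_simps)
  have [simp]: "dim_row x = n" "dim_col x = n" "dim_row y = n" "dim_col y = n"
    using c by auto
  show "x \<otimes>\<^bsub>?L\<^esub> y \<in> carrier ?L"
  proof -
    have "x * y \<in> carrier_mat n n" "y * x \<in> carrier_mat n n"
      using c by auto
    moreover from this have "mat_trace (x * y - y * x) = 0"
      by (simp add: mat_trace_simps mat_trace_mult_comm[OF c])
    ultimately show ?thesis
      by (simp add: sl_simps minus_carrier_mat)
  qed
  show "a \<odot>\<^bsub>?L\<^esub> x \<otimes>\<^bsub>?L\<^esub> y = a \<odot>\<^bsub>?L\<^esub> (x \<otimes>\<^bsub>?L\<^esub> y)"
    "x \<otimes>\<^bsub>?L\<^esub> (a \<odot>\<^bsub>?L\<^esub> y) = a \<odot>\<^bsub>?L\<^esub> (x \<otimes>\<^bsub>?L\<^esub> y)"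
    using c by (auto simp: sl_simps algebra_simps intro!: eq_matI)
  show "x \<otimes>\<^bsub>?L\<^esub> x = \<zero>\<^bsub>?L\<^esub>"
    using c by (auto simp: sl_simps)
  assume "z \<in> carrier ?L"
  then have z: "z \<in> carrier_mat n n"
    by (simp add: sl_simps)
  have [simp]: "dim_row z = n" "dim_col z = n"
    using z by auto
  show "(x \<oplus>\<^bsub>?L\<^esub> y) \<otimes>\<^bsub>?L\<^esub> z = x \<otimes>\<^bsub>?L\<^esub> z \<oplus>\<^bsub>?L\<^esub> y \<otimes>\<^bsub>?L\<^esub> z"
    "z \<otimes>\<^bsub>?L\<^esub> (x \<oplus>\<^bsub>?L\<^esub> y) = z \<otimes>\<^bsub>?L\<^esub> x \<oplus>\<^bsub>?L\<^esub> z \<otimes>\<^bsub>?L\<^esub> y"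
    using c z add_mult_distrib_mat[of x n n y z n] mult_add_distrib_mat[of z n n x n y]
    by (auto simp: sl_simps intro!: eq_matI)
  have "x * (y * z - z * y) - (y * z - z * y) * x + (y * (z * x - x * z) - (z * x - x * z) * y)
      + (z * (x * y - y * x) - (x * y - y * x) * z) = 0\<^sub>m n n"
    using c z
    by (simp add: mult_minus_distrib_mat[of _ n n _ n] minus_mult_distrib_mat[of _ n n _ _ n]
        assoc_mult_mat[of _ n n _ n _ n]) (auto intro!: eq_matI)
  then show "x \<otimes>\<^bsub>?L\<^esub> (y \<otimes>\<^bsub>?L\<^esub> z) \<oplus>\<^bsub>?L\<^esub> y \<otimes>\<^bsub>?L\<^esub> (z \<otimes>\<^bsub>?L\<^esub> x)
      \<oplus>\<^bsub>?L\<^esub> z \<otimes>\<^bsub>?L\<^esub> (x \<otimes>\<^bsub>?L\<^esub> y) = \<zero>\<^bsub>?L\<^esub>"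
    by (simp add: sl_simps)
qed

lemma lie_ideal_scalar_mats:
  "lie_ideal class_ring (scalar_mats TYPE('a::field) n \<inter> carrier (sl TYPE('a) n)) (sl TYPE('a) n)"
proof -
  let ?L = "sl TYPE('a) n" and ?Z = "scalar_mats TYPE('a) n"
  interpret vectorspace class_ring ?L
    by (rule vectorspace_sl)
  have add: "x \<oplus>\<^bsub>?L\<^esub> y \<in> ?Z" if "x \<in> ?Z" "y \<in> ?Z" for x y
    using that by (auto simp: sl_simps scalar_mats_def
      add_smult_distrib_right_mat[OF one_carrier_mat, symmetric])
  have smult: "a \<odot>\<^bsub>?L\<^esub> x \<in> ?Z" if "x \<in> ?Z" for a x
  proof -
    have "a \<cdot>\<^sub>m (c \<cdot>\<^sub>m 1\<^sub>m n) = (a * c) \<cdot>\<^sub>m 1\<^sub>m n" for c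
      by (auto intro!: eq_matI)
    then show ?thesis
      using that by (auto simp: sl_simps scalar_mats_def)
  qed
  have zero: "\<zero>\<^bsub>?L\<^esub> \<in> ?Z"
    by (auto simp: sl_simps scalar_mats_def intro!: eq_matI image_eqI[of _ _ 0])
  have sub: "submodule class_ring (?Z \<inter> carrier ?L) ?L"
  proof (intro submodule.intro module_axioms)
    show "?Z \<inter> carrier ?L \<subseteq> carrier ?L"
      by (rule Int_lower2)
    show "\<zero>\<^bsub>?L\<^esub> \<in> ?Z \<inter> carrier ?L"
      using zero M.zero_closed by (rule IntI)
    show "v \<oplus>\<^bsub>?L\<^esub> w \<in> ?Z \<inter> carrier ?L" if "v \<in> ?Z \<inter> carrier ?L" "w \<in> ?Z \<inter> carrier ?L" for v w
      using add[OF IntD1 IntD1, OF that] M.add.m_closed[OF IntD2 IntD2, OF that] by (rule IntI)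
    show "a \<odot>\<^bsub>?L\<^esub> v \<in> ?Z \<inter> carrier ?L"
      if "a \<in> carrier class_ring" "v \<in> ?Z \<inter> carrier ?L" for a v
      using smult[OF IntD1, OF that(2)] smult_closed[OF that(1) IntD2, OF that(2)] by (rule IntI)
  qed
  have "x \<otimes>\<^bsub>?L\<^esub> y = \<zero>\<^bsub>?L\<^esub>" "y \<otimes>\<^bsub>?L\<^esub> x = \<zero>\<^bsub>?L\<^esub>"
    if xy: "x \<in> carrier ?L" "y \<in> ?Z" for x y
  proof -
    obtain c where "x \<in> carrier_mat n n" "y = c \<cdot>\<^sub>m 1\<^sub>m n"
      using xy by (auto simp: sl_simps scalar_mats_def)
    then have "x * y = c \<cdot>\<^sub>m x" "y * x = c \<cdot>\<^sub>m x"
      by (simp_all add: mult_smult_distrib[of _ n n _ n] mult_smult_assoc_mat[of _ n n])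
    then show "x \<otimes>\<^bsub>?L\<^esub> y = \<zero>\<^bsub>?L\<^esub>" "y \<otimes>\<^bsub>?L\<^esub> x = \<zero>\<^bsub>?L\<^esub>"
      using \<open>x \<in> carrier_mat n n\<close> by (simp_all add: sl_simps)
  qed
  note central = this
  have zero_in: "\<zero>\<^bsub>?L\<^esub> \<in> ?Z \<inter> carrier ?L"
    using zero M.zero_closed by (rule IntI)
  show ?thesis
    unfolding lie_ideal_def subspace_def
  proof (intro conjI ballI vectorspace_sl sub)
    fix x y assume x: "x \<in> carrier ?L" and y: "y \<in> ?Z \<inter> carrier ?L"
    show "x \<otimes>\<^bsub>?L\<^esub> y \<in> ?Z \<inter> carrier ?L"
      unfolding central(1)[OF x IntD1[OF y]] by (rule zero_in)
    show "y \<otimes>\<^bsub>?L\<^esub> x \<in> ?Z \<inter> carrier ?L"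
      unfolding central(2)[OF x IntD1[OF y]] by (rule zero_in)
  qed
qed

lemma lie_algebra_psl: "lie_algebra class_ring (psl TYPE('a::field) n)"
  unfolding psl_def
  by (rule lie_algebra.lie_ideal_quotient[OF lie_algebra_sl lie_ideal_scalar_mats])

end

theory Submission
  imports Defs
begin

text \<open>Outside the excluded pairs already \<open>sl\<^sub>n\<close> is generated by two
  elements, and then so is its quotient. The generators \<open>X\<close> and \<open>Y\<close> are sums of matrix units with
  coefficients \<open>1\<close> and \<open>-1\<close>, so the size of the field does not matter; all that matters is whether
  \<open>2\<close> or \<open>3\<close> vanishes in it. In each case a diagonal element that is at hand splits the other elements
  into eigenvectors of its adjoint action. Brackets of the parts give further diagonal elements, which
  split the parts further, until single matrix units come out. Once all units in row \<open>0\<close> and in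
  column \<open>0\<close> off the diagonal are there, their brackets span \<open>sl\<^sub>n\<close> (\<open>sl_subset_if_hub\<close>).
  Indices run from \<open>0\<close> to \<open>m = n - 1\<close>, and \<open>E i j\<close> are the matrix units.

  If \<open>2\<close> is invertible and \<open>n \<ge> 4\<close> (\<open>generators_odd\<close>), take \<open>X = E 0 0 - E 1 1\<close> and for \<open>Y\<close> a nilpotent
  Jordan block \<open>R\<close> on the indices \<open>2, ..., m\<close> together with entries \<open>P\<close> and \<open>Q\<close> that link this block
  to \<open>0\<close> and \<open>1\<close> in both directions. The parts \<open>P, Q, R\<close> have eigenvalues \<open>1, -1, 0\<close> under \<open>X\<close>, so each of
  them is obtained from \<open>Y\<close>.

  In characteristic \<open>2\<close> the eigenvalues \<open>1\<close> and \<open>-1\<close> coincide, and a diagonal \<open>X\<close> no longer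
  distinguishes the two directions. For \<open>n \<ge> 5\<close> (\<open>generators_char_2\<close>) take instead \<open>X = h + E m 0\<close>, where
  the diagonal \<open>h = E 1 1 + E 2 2\<close> satisfies \<open>h * E m 0 = E m 0 * h = 0\<close>, and for \<open>Y\<close> the full nilpotent
  Jordan block. Since \<open>X\<^sup>2 = h\<close>, applying the adjoint action of \<open>X\<close> twice is the adjoint action of \<open>h\<close>; on
  what \<open>h\<close> annihilates, \<open>X\<close> acts as the nilpotent \<open>E m 0\<close> does. This separates enough of \<open>Y\<close>
  to recover \<open>h\<close> and \<open>E m 0\<close> individually.

  For \<open>n = 3\<close> (\<open>generators_3\<close>) the two generators are sums of edges of the cycle \<open>0 \<rightarrow> 1 \<rightarrow> 2 \<rightarrow> 0\<close>,
  and they produce a diagonal element with eigenvalues \<open>3, 0, -3\<close> on the three edges, which separates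
  them unless \<open>p = 3\<close>. The cases \<open>n \<le> 2\<close> are immediate.\<close>

section \<open>Passing to a quotient\<close>

context lie_algebra
begin

lemma carrier_lie_subalgebra: "lie_subalgebra K (carrier L) L"
  unfolding lie_subalgebra_def subspace_def
  by (auto intro!: submodule.intro vectorspace_axioms module_axioms bracket_closed)

text \<open>Cosets can be computed with representatives because an ideal absorbs brackets on both
  sides; this is what makes the projection onto the quotient a homomorphism.\<close>

lemma lie_quotient_projection:
  assumes ideal: "lie_ideal K I L"
  shows "\<lbrakk>x \<in> carrier L; y \<in> carrier L\<rbrakk>
      \<Longrightarrow> (I +> x) \<oplus>\<^bsub>lie_quotient L I\<^esub> (I +> y) = I +> (x \<oplus> y)"
    and "\<lbrakk>a \<in> carrier K; x \<in> carrier L\<rbrakk> \<Longrightarrow> a \<odot>\<^bsub>lie_quotient L I\<^esub> (I +> x) = I +> (a \<odot> x)"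
    and "\<lbrakk>x \<in> carrier L; y \<in> carrier L\<rbrakk>
      \<Longrightarrow> (I +> x) \<otimes>\<^bsub>lie_quotient L I\<^esub> (I +> y) = I +> (x \<otimes> y)"
    and "\<zero>\<^bsub>lie_quotient L I\<^esub> = I +> \<zero>"
proof -
  interpret I: abelian_subgroup I L
    by (rule lie_ideal_abelian_subgroup[OF ideal])
  have sub: "submodule K I L"
    using ideal by (simp add: lie_ideal_def subspace_def)
  have absorb: "I +> (h \<oplus> x) = I +> x" if "h \<in> I" "x \<in> carrier L" for h x
  proof -
    have "h \<oplus> x \<in> I +> x"
      using that by (auto simp: a_r_coset_def')
    then show ?thesis
      using a_repr_independence[OF _ that(2) I.a_subgroup] by simp
  qed
  have rep: "\<exists>h \<in> I. y = h \<oplus> x" if "y \<in> I +> x" for x y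
    using that by (auto simp: a_r_coset_def')
  have inL: "h \<in> carrier L" if "h \<in> I" for h
    using submodule.subset[OF sub] that by blast
  have I_bracket: "x \<otimes> h \<in> I" "h \<otimes> x \<in> I" if "x \<in> carrier L" "h \<in> I" for x h
    using ideal that by (auto simp: lie_ideal_def)
  show "(I +> x) \<oplus>\<^bsub>lie_quotient L I\<^esub> (I +> y) = I +> (x \<oplus> y)"
    if "x \<in> carrier L" "y \<in> carrier L"
    using I.a_rcos_sum that by (simp add: lie_quotient_simps)
  show "a \<odot>\<^bsub>lie_quotient L I\<^esub> (I +> x) = I +> (a \<odot> x)"
    if a: "a \<in> carrier K" and x: "x \<in> carrier L"
  proof -
    have "I +> (a \<odot> y) = I +> (a \<odot> x)" if "y \<in> I +> x" for y
    proof -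
      obtain h where h: "h \<in> I" "y = h \<oplus> x"
        using rep[OF \<open>y \<in> I +> x\<close>] by blast
      then have "a \<odot> y = a \<odot> h \<oplus> a \<odot> x"
        using a x inL by (simp add: smult_r_distr)
      then show ?thesis
        using absorb[OF submodule.smult_closed[OF sub a h(1)], of "a \<odot> x"] a x by simp
    qed
    then show ?thesis
      using I.a_rcos_self[OF x] unfolding lie_quotient_simps by blast
  qed
  show "(I +> x) \<otimes>\<^bsub>lie_quotient L I\<^esub> (I +> y) = I +> (x \<otimes> y)"
    if x: "x \<in> carrier L" and y: "y \<in> carrier L"
  proof -
    have "I +> (v \<otimes> w) = I +> (x \<otimes> y)" if v: "v \<in> I +> x" and w: "w \<in> I +> y" for v w
    proof -
      obtain h k where h: "h \<in> I" "v = h \<oplus> x" and k: "k \<in> I" "w = k \<oplus> y"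
        using rep[OF v] rep[OF w] by blast
      have hk: "h \<in> carrier L" "k \<in> carrier L"
        using h k inL by auto
      have "v \<otimes> w = (h \<otimes> k \<oplus> x \<otimes> k) \<oplus> h \<otimes> y \<oplus> x \<otimes> y"
        using hk x y
        by (simp add: h k bracket_add_left bracket_add_right bracket_closed M.add.m_assoc)
      moreover have "(h \<otimes> k \<oplus> x \<otimes> k) \<oplus> h \<otimes> y \<in> I"
        using h k x y hk by (intro I.a_closed I_bracket)
      ultimately show ?thesis
        using absorb bracket_closed x y by simp
    qed
    then show ?thesis
      using I.a_rcos_self[OF x] I.a_rcos_self[OF y]
      unfolding lie_quotient_simps rcoset_mult_def by blast
  qed
  show "\<zero>\<^bsub>lie_quotient L I\<^esub> = I +> \<zero>"
    using a_coset_join2[OF zero_closed I.a_subgroup] I.zero_closed by (simp add: lie_quotient_simps)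
qed

text \<open>The preimage of a subalgebra under the projection is a subalgebra, so images of generators
  generate the quotient.\<close>

lemma k_generated_quotient:
  assumes ideal: "lie_ideal K I L" and gen: "k_generated k K L"
  shows "k_generated k K (lie_quotient L I)"
proof -
  let ?Q = "lie_quotient L I"
  note proj = lie_quotient_projection[OF ideal]
  interpret Q: lie_algebra K ?Q
    by (rule lie_ideal_quotient[OF ideal])
  obtain xs where xs: "length xs = k" "set xs \<subseteq> carrier L" "lie_generated K L (set xs) = carrier L"
    using gen by (auto simp: k_generated_def)
  let ?ys = "map (\<lambda>x. I +> x) xs"
  have carQ: "carrier ?Q = (\<lambda>x. I +> x) ` carrier L"
    by (auto simp: lie_quotient_simps A_RCOSETS_def')
  have ys: "set ?ys \<subseteq> carrier ?Q"
    using xs(2) by (auto simp: carQ)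
  have "carrier ?Q \<subseteq> T" if T: "lie_subalgebra K T ?Q" "set ?ys \<subseteq> T" for T
  proof -
    have sub: "submodule K T ?Q" and br: "\<And>x y. x \<in> T \<Longrightarrow> y \<in> T \<Longrightarrow> x \<otimes>\<^bsub>?Q\<^esub> y \<in> T"
      using T(1) by (auto simp: lie_subalgebra_def subspace_def)
    define S where "S = {x \<in> carrier L. I +> x \<in> T}"
    have "lie_subalgebra K S L"
      unfolding lie_subalgebra_def subspace_def
    proof (intro conjI ballI vectorspace_axioms submodule.intro module_axioms)
      show "\<zero> \<in> S"
        using submodule.zero_closed[OF sub] by (simp add: S_def proj(4))
      show "x \<oplus> y \<in> S" if "x \<in> S" "y \<in> S" for x y
        using that submodule.m_closed[OF sub, of "I +> x" "I +> y"] by (simp add: S_def proj(1))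
      show "a \<odot> x \<in> S" if "a \<in> carrier K" "x \<in> S" for a x
        using that submodule.smult_closed[OF sub, of a "I +> x"] by (simp add: S_def proj(2))
      show "x \<otimes> y \<in> S" if "x \<in> S" "y \<in> S" for x y
        using that br[of "I +> x" "I +> y"] by (simp add: S_def proj(3) bracket_closed)
    qed (auto simp: S_def)
    moreover have "set xs \<subseteq> S"
      using xs(2) T(2) by (auto simp: S_def)
    ultimately have "carrier L \<subseteq> S"
      using xs(3) by (auto simp: lie_generated_def)
    then show ?thesis
      by (auto simp: carQ S_def)
  qed
  then have "lie_generated K ?Q (set ?ys) = carrier ?Q"
    unfolding lie_generated_def
    using Q.carrier_lie_subalgebra ys by (intro equalityI Inter_lower Inter_greatest) auto
  then show ?thesis
    unfolding k_generated_def using xs(1) ys by (intro exI[of _ ?ys]) simp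
qed

end

section \<open>Commutators of matrix units\<close>

definition unit_mat :: "nat \<Rightarrow> nat \<Rightarrow> nat \<Rightarrow> 'a::field mat"
  where "unit_mat n i j = mat n n (\<lambda>(r, s). if r = i \<and> s = j then 1 else 0)"

text \<open>The nilpotent Jordan block on the indices from \<open>c\<close> on.\<close>

definition shift_mat :: "nat \<Rightarrow> nat \<Rightarrow> 'a::field mat"
  where "shift_mat n c = mat n n (\<lambda>(r, s). if c \<le> r \<and> s = Suc r then 1 else 0)"

definition comm :: "'a::field mat \<Rightarrow> 'a mat \<Rightarrow> 'a mat"
  where "comm A B = A * B - B * A"

lemma unit_mat_carrier [simp]: "unit_mat n i j \<in> carrier_mat n n"
  and shift_mat_carrier [simp]: "shift_mat n c \<in> carrier_mat n n"
  by (simp_all add: unit_mat_def shift_mat_def)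

lemma dim_unit_shift [simp]:
  "dim_row (unit_mat n i j) = n" "dim_col (unit_mat n i j) = n"
  "dim_row (shift_mat n c) = n" "dim_col (shift_mat n c) = n"
  by (simp_all add: unit_mat_def shift_mat_def)

lemma index_unit_shift [simp]:
  assumes "r < n" "s < n"
  shows "unit_mat n i j $$ (r, s) = of_bool (r = i \<and> s = j)"
    "shift_mat n c $$ (r, s) = of_bool (c \<le> r \<and> s = Suc r)"
  using assms by (simp_all add: unit_mat_def shift_mat_def)

lemma comm_carrier [simp]:
  "\<lbrakk>A \<in> carrier_mat n n; B \<in> carrier_mat n n\<rbrakk> \<Longrightarrow> comm A B \<in> carrier_mat n n"
  by (simp add: comm_def minus_carrier_mat)

lemma dim_comm [simp]: "dim_row (comm A B) = dim_row B" "dim_col (comm A B) = dim_col A"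
  by (simp_all add: comm_def)

lemma index_comm_unit:
  assumes "A \<in> carrier_mat n n" "i < n" "j < n" "r < n" "s < n"
  shows "comm (unit_mat n i j) A $$ (r, s)
    = (if r = i then A $$ (j, s) else 0) - (if s = j then A $$ (r, i) else 0)"
proof -
  have "(unit_mat n i j * A) $$ (r, s) = (\<Sum>k<n. of_bool (r = i \<and> k = j) * A $$ (k, s))"
    using assms by (simp add: scalar_prod_def atLeast0LessThan)
  also have "\<dots> = (\<Sum>k<n. if k = j then (if r = i then A $$ (k, s) else 0) else 0)"
    by (intro sum.cong) auto
  also have "\<dots> = (if r = i then A $$ (j, s) else 0)"
    using assms by (simp add: sum.delta)
  finally have left: "(unit_mat n i j * A) $$ (r, s) = (if r = i then A $$ (j, s) else 0)" .
  have "(A * unit_mat n i j) $$ (r, s) = (\<Sum>k<n. A $$ (r, k) * of_bool (k = i \<and> s = j))"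
    using assms by (simp add: scalar_prod_def atLeast0LessThan)
  also have "\<dots> = (\<Sum>k<n. if k = i then (if s = j then A $$ (r, k) else 0) else 0)"
    by (intro sum.cong) auto
  also have "\<dots> = (if s = j then A $$ (r, i) else 0)"
    using assms by (simp add: sum.delta)
  finally show ?thesis
    using assms left by (simp add: comm_def)
qed

lemma comm_linear:
  assumes "A \<in> carrier_mat n n" "B \<in> carrier_mat n n" "C \<in> carrier_mat n n"
  shows "comm (A + B) C = comm A C + comm B C" "comm (A - B) C = comm A C - comm B C"
    "comm C (A + B) = comm C A + comm C B" "comm C (A - B) = comm C A - comm C B"
  using assms
  by (auto simp: comm_def add_mult_distrib_mat[of _ n n] mult_add_distrib_mat[of _ n n _ n]
      minus_mult_distrib_mat[of _ n n] mult_minus_distrib_mat[of _ n n _ n] intro: eq_matI)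

lemma comm_units:
  assumes "i < n" "j < n" "k < n" "i \<noteq> k"
  shows "comm (unit_mat n i j) (unit_mat n j k) = unit_mat n i k"
  using assms by (intro eq_matI) (auto simp: index_comm_unit)


section \<open>Lie algebras of matrices that contain all matrix units\<close>

locale matrix_lie_algebra =
  fixes n :: nat and S :: "'a::field mat set"
  assumes subset: "S \<subseteq> carrier_mat n n"
    and zero: "0\<^sub>m n n \<in> S"
    and add: "\<lbrakk>A \<in> S; B \<in> S\<rbrakk> \<Longrightarrow> A + B \<in> S"
    and smult: "A \<in> S \<Longrightarrow> c \<cdot>\<^sub>m A \<in> S"
    and comm: "\<lbrakk>A \<in> S; B \<in> S\<rbrakk> \<Longrightarrow> comm A B \<in> S"
begin

abbreviation E :: "nat \<Rightarrow> nat \<Rightarrow> 'a mat"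
  where "E \<equiv> unit_mat n"

lemma carrier: "A \<in> S \<Longrightarrow> A \<in> carrier_mat n n"
  using subset by blast

lemma diff: "A - B \<in> S" if "A \<in> S" "B \<in> S"
proof -
  have "A - B = A + (- 1) \<cdot>\<^sub>m B"
    using that[THEN carrier] by (auto intro!: eq_matI)
  then show ?thesis
    using add smult that by simp
qed

lemma uminus: "- A \<in> S" if "A \<in> S"
proof -
  have "- A = (- 1) \<cdot>\<^sub>m A"
    using carrier[OF that] by (auto intro!: eq_matI)
  then show ?thesis
    using smult that by simp
qed

text \<open>Membership of a matrix is proved by computing some bracket of known elements entrywise.\<close>

lemma mem_eqI:
  assumes "B \<in> S" "A \<in> carrier_mat n n" "\<And>r s. \<lbrakk>r < n; s < n\<rbrakk> \<Longrightarrow> A $$ (r, s) = B $$ (r, s)"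
  shows "A \<in> S"
proof -
  have "A = B"
    using assms carrier[OF assms(1)] by (intro eq_matI) auto
  then show ?thesis
    using assms(1) by simp
qed

lemma comm_unit: "E i k \<in> S"
  if "E i j \<in> S" "E j k \<in> S" "i < n" "j < n" "k < n" "i \<noteq> k"
  using comm[OF that(1,2)] comm_units[OF that(3-6), where 'a = 'a] by simp

lemma off_diagonal_part:
  assumes off: "\<And>i j. \<lbrakk>i < n; j < n; i \<noteq> j\<rbrakk> \<Longrightarrow> E i j \<in> S"
    and "finite P" "P \<subseteq> {(i, j). i < n \<and> j < n \<and> i \<noteq> j}"
  shows "mat n n (\<lambda>p. if p \<in> P then f p else 0) \<in> S"
  using assms(2,3)
proof (induction P rule: finite_induct)
  case empty
  have "mat n n (\<lambda>p. if p \<in> {} then f p else 0) = 0\<^sub>m n n"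
    by (auto intro!: eq_matI)
  then show ?case
    using zero by simp
next
  case (insert q P)
  obtain i j where q: "q = (i, j)"
    by fastforce
  have "mat n n (\<lambda>p. if p \<in> insert q P then f p else 0)
      = f q \<cdot>\<^sub>m E i j + mat n n (\<lambda>p. if p \<in> P then f p else 0)"
    using insert.hyps q by (intro eq_matI) auto
  moreover have "E i j \<in> S"
    using insert.prems q by (intro off) auto
  ultimately show ?case
    using insert by (simp add: add smult)
qed

text \<open>The brackets \<open>comm (E k 0) (E 0 k) = E k k - E 0 0\<close> supply arbitrary diagonal entries at positive
  indices; the entry at \<open>0\<close> is then forced by the trace.\<close>

lemma diagonal_part:
  assumes off: "\<And>i j. \<lbrakk>i < n; j < n; i \<noteq> j\<rbrakk> \<Longrightarrow> E i j \<in> S"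
    and "finite D" "D \<subseteq> {0<..<n}"
  shows "mat n n (\<lambda>(i, j). if i \<noteq> j then 0 else if i \<in> D then d i
    else if i = 0 then - (\<Sum>k\<in>D. d k) else 0) \<in> S" (is "?M D \<in> S")
  using assms(2,3)
proof (induction D rule: finite_induct)
  case empty
  have "?M {} = 0\<^sub>m n n"
    by (auto intro!: eq_matI)
  then show ?case
    using zero by simp
next
  case (insert k D)
  have k: "0 < k" "k < n"
    using insert.prems by auto
  have "comm (E k 0) (E 0 k) \<in> S"
    using k by (intro comm off) auto
  moreover have "?M (insert k D) = d k \<cdot>\<^sub>m comm (E k 0) (E 0 k) + ?M D"
    using insert k by (intro eq_matI) (auto simp: index_comm_unit)
  ultimately show ?case
    using insert by (simp add: add smult)
qed

lemma sl_subset_if_units: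
  assumes off: "\<And>i j. \<lbrakk>i < n; j < n; i \<noteq> j\<rbrakk> \<Longrightarrow> E i j \<in> S"
    and n: "n > 0" and A: "A \<in> carrier_mat n n" "mat_trace A = 0"
  shows "A \<in> S"
proof -
  let ?P = "{(i, j). i < n \<and> j < n \<and> i \<noteq> j}"
  have "?P \<subseteq> {..<n} \<times> {..<n}"
    by auto
  then have "finite ?P"
    by (rule finite_subset) simp
  then have offd: "mat n n (\<lambda>p. if p \<in> ?P then A $$ p else 0) \<in> S"
    by (intro off_diagonal_part off) auto
  have diag: "mat n n (\<lambda>(i, j). if i \<noteq> j then 0 else if i \<in> {0<..<n} then A $$ (i, i)
    else if i = 0 then - (\<Sum>k\<in>{0<..<n}. A $$ (k, k)) else 0) \<in> S"
    by (intro diagonal_part off) auto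
  have "{..<n} = insert 0 {0<..<n}"
    using n by auto
  then have "A $$ (0, 0) = - (\<Sum>k\<in>{0<..<n}. A $$ (k, k))"
    using A by (simp add: mat_trace_def eq_neg_iff_add_eq_0)
  then have "A = mat n n (\<lambda>p. if p \<in> ?P then A $$ p else 0)
    + mat n n (\<lambda>(i, j). if i \<noteq> j then 0 else if i \<in> {0<..<n} then A $$ (i, i)
    else if i = 0 then - (\<Sum>k\<in>{0<..<n}. A $$ (k, k)) else 0)"
    using A(1) by (intro eq_matI) auto
  then show ?thesis
    using add[OF offd diag] by simp
qed

lemma sl_subset_if_hub:
  assumes hub: "\<And>j. \<lbrakk>0 < j; j < n\<rbrakk> \<Longrightarrow> E 0 j \<in> S" "\<And>j. \<lbrakk>0 < j; j < n\<rbrakk> \<Longrightarrow> E j 0 \<in> S"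
    and "n > 0" "A \<in> carrier_mat n n" "mat_trace A = 0"
  shows "A \<in> S"
proof (rule sl_subset_if_units[OF _ assms(3-5)])
  fix i j assume ij: "i < n" "j < n" "i \<noteq> j"
  then show "E i j \<in> S"
    using hub comm_unit[of i 0 j] by (cases "i = 0"; cases "j = 0") auto
qed

section \<open>Explicit generators\<close>

text \<open>Entries of units and shifts are indicators. Without case splits they remain atoms, and an entrywise
  identity between brackets of sums becomes a linear identity in them.\<close>

declare split_of_bool [split del]

lemma comm_unit_unit:
  assumes "i < n" "j < n" "k < n" "l < n"
  shows "comm (E i j) (E k l)
    = (if j = k then E i l else 0\<^sub>m n n) - (if l = i then E k j else 0\<^sub>m n n)"
  using assms by (intro eq_matI) (auto simp: index_comm_unit split: split_of_bool)

lemma comm_unit_shift: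
  assumes "i < n" "j < n"
  shows "comm (E i j) (shift_mat n c)
    = (if c \<le> j \<and> Suc j < n then E i (Suc j) else 0\<^sub>m n n)
      - (if c < i then E (i - 1) j else 0\<^sub>m n n)"
  using assms by (intro eq_matI) (auto simp: index_comm_unit split: split_of_bool)

lemmas comm_simps = comm_linear[where n = n] comm_unit_unit comm_unit_shift minus_carrier_mat numeral_2_eq_2[symmetric]

text \<open>An element acting on a row or a column of units by single steps produces the units of a whole
  segment from the one at its end.\<close>

lemma row_segment:
  assumes "E i c \<in> S" "N \<in> S"
    and "\<And>k. \<lbrakk>c \<le> k; Suc k < n\<rbrakk> \<Longrightarrow> comm (E i k) N = E i (Suc k)"
    and "c \<le> j" "j < n"
  shows "E i j \<in> S"
  using assms(4,5)
proof (induction j rule: dec_induct)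
  case base
  then show ?case
    using assms(1) by simp
next
  case (step j)
  then show ?case
    using comm[of "E i j" N] assms(2,3) by simp
qed

lemma column_segment:
  assumes "E l j \<in> S" "N \<in> S"
    and "\<And>k. \<lbrakk>i \<le> k; k < l\<rbrakk> \<Longrightarrow> comm (E (Suc k) j) N = - E k j"
    and "i \<le> l"
  shows "E i j \<in> S"
  using assms(4)
proof (induction i rule: inc_induct)
  case base
  show ?case
    by (rule assms(1))
next
  case (step k)
  have "- comm (E (Suc k) j) N \<in> S"
    using comm[OF step.IH assms(2)] by (rule uminus)
  then show ?case
    using assms(3)[of k] step by simp
qed

text \<open>The links \<open>P = E 0 2 + E 2 1\<close> and \<open>Q = E m 0 + E 1 m\<close> attach to opposite ends of the Jordan block \<open>R\<close>,
  so that \<open>R\<close> annihilates one of the two units in each of \<open>P\<close> and \<open>Q\<close> and carries the other along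
  the block. That already yields single units.\<close>

lemma generators_odd:
  assumes two: "(2::'a) \<noteq> 0" and n: "n \<ge> 4"
    and X: "E 0 0 - E 1 1 \<in> S"
    and Y: "E 0 2 + E 2 1 + (E (n - 1) 0 + E 1 (n - 1)) + shift_mat n 2 \<in> S"
    and A: "A \<in> carrier_mat n n" "mat_trace A = 0"
  shows "A \<in> S"
proof -
  define m where "m = n - 1"
  have m: "m < n" "3 \<le> m" "Suc m = n"
    using n by (auto simp: m_def)
  define P where "P = E 0 2 + E 2 1"
  define Q where "Q = E m 0 + E 1 m"
  define R where "R = (shift_mat n 2 :: 'a mat)"
  have carr: "P \<in> carrier_mat n n" "Q \<in> carrier_mat n n" "R \<in> carrier_mat n n"
    by (simp_all add: P_def Q_def R_def)
  have Y: "P + Q + R \<in> S"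
    using Y by (simp add: P_def Q_def R_def m_def)
  \<comment> \<open>The eigenvalues of \<open>X\<close> on \<open>P\<close>, \<open>Q\<close>, \<open>R\<close> are \<open>1\<close>, \<open>-1\<close>, \<open>0\<close>.\<close>
  have diff_PQ: "P - Q \<in> S"
    by (rule mem_eqI[OF comm[OF X Y]])
      (use m in \<open>simp_all add: comm_simps P_def Q_def R_def\<close>)
  have sum_PQ: "P + Q \<in> S"
    by (rule mem_eqI[OF comm[OF X diff_PQ]])
      (use m in \<open>simp_all add: comm_simps P_def Q_def R_def\<close>)
  have P: "P \<in> S"
    by (rule mem_eqI[OF smult[OF add[OF diff_PQ sum_PQ], of "1 / 2"]])
      (use two carr in \<open>auto simp: field_simps\<close>)
  have Q: "Q \<in> S"
    by (rule mem_eqI[OF diff[OF sum_PQ P]]) (use carr in auto)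
  have R: "R \<in> S"
    by (rule mem_eqI[OF diff[OF Y sum_PQ]]) (use carr in auto)
  have "E 0 3 \<in> S"
    by (rule mem_eqI[OF comm[OF P R]])
      (use m in \<open>simp_all add: comm_simps P_def R_def\<close>)
  then have row: "E 0 j \<in> S" if "3 \<le> j" "j < n" for j
    by (rule row_segment[OF _ R _ that])
      (use m in \<open>auto simp: comm_simps R_def intro!: eq_matI\<close>)
  have "E (m - 1) 0 \<in> S"
    by (rule mem_eqI[OF uminus[OF comm[OF Q R]]])
      (use m in \<open>simp_all add: comm_simps Q_def R_def\<close>)
  then have column: "E i 0 \<in> S" if "2 \<le> i" "i < m" for i
    by (rule column_segment[OF _ R])
      (use that m in \<open>auto simp: comm_simps R_def intro!: eq_matI\<close>)
  \<comment> \<open>This diagonal element has eigenvalues \<open>1\<close> and \<open>0\<close> on the two units in \<open>P\<close>, and the one obtained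
    from \<open>E 2 0\<close> below has eigenvalues \<open>1\<close> and \<open>0\<close> on those in \<open>Q\<close>.\<close>
  have "E 0 0 - E m m \<in> S"
    by (rule mem_eqI[OF comm[OF row[of m] Q]])
      (use m in \<open>simp_all add: comm_simps Q_def\<close>)
  then have E02: "E 0 2 \<in> S"
    by (rule mem_eqI[OF comm[OF _ P, of "E 0 0 - E m m"]])
      (use m in \<open>simp_all add: comm_simps P_def\<close>)
  have E21: "E 2 1 \<in> S"
    by (rule mem_eqI[OF diff[OF P E02]])
      (auto simp: P_def)
  have "E 2 2 - E 0 0 \<in> S"
    by (rule mem_eqI[OF comm[OF column[of 2] P]])
      (use m in \<open>simp_all add: comm_simps P_def\<close>)
  then have Em0: "E m 0 \<in> S"
    by (rule mem_eqI[OF comm[OF _ Q, of "E 2 2 - E 0 0"]])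
      (use m in \<open>simp_all add: comm_simps Q_def\<close>)
  have E1m: "E 1 m \<in> S"
    by (rule mem_eqI[OF diff[OF Q Em0]])
      (auto simp: Q_def)
  have E01: "E 0 1 \<in> S"
    using comm_unit[OF E02 E21] m by simp
  have E10: "E 1 0 \<in> S"
    using comm_unit[OF E1m Em0] m by simp
  show ?thesis
  proof (rule sl_subset_if_hub[OF _ _ _ A])
    fix j assume j: "0 < j" "j < n"
    then consider "j = 1" | "j = 2" | "3 \<le> j"
      by linarith
    then show "E 0 j \<in> S"
      using E01 E02 row j by cases auto
    consider "j = 1" | "2 \<le> j" "j < m" | "j = m"
      using j m by linarith
    then show "E j 0 \<in> S"
      using E10 Em0 column by cases auto
  qed (use m in simp)
qed

lemma generators_3:
  assumes three: "(3::'a) \<noteq> 0" and n: "n = 3"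
    and X: "E 0 1 + E 1 2 \<in> S" and Y: "E 0 1 + E 2 0 \<in> S"
    and A: "A \<in> carrier_mat n n" "mat_trace A = 0"
  shows "A \<in> S"
proof -
  have lt: "0 < n" "1 < n" "2 < n"
    using n by simp_all
  have C: "E 1 0 - E 0 2 - E 2 1 \<in> S"
    by (rule mem_eqI[OF comm[OF X Y]])
      (use lt in \<open>simp_all add: comm_simps\<close>)
  \<comment> \<open>Eigenvalue \<open>3\<close> on \<open>E 0 1\<close> and \<open>0\<close> on \<open>E 1 2\<close>.\<close>
  have "E 0 0 + E 0 0 - E 1 1 - E 2 2 \<in> S"
    by (rule mem_eqI[OF comm[OF Y C]])
      (use lt in \<open>simp_all add: comm_simps\<close>)
  from comm[OF this X] have E01: "E 0 1 \<in> S"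
    by (rule mem_eqI[OF smult[of _ "1 / 3"], of "comm (E 0 0 + E 0 0 - E 1 1 - E 2 2) (E 0 1 + E 1 2)"])
      (use lt three in \<open>simp_all add: comm_simps field_simps\<close>)
  have E12: "E 1 2 \<in> S"
    by (rule mem_eqI[OF diff[OF X E01]]) auto
  have E20: "E 2 0 \<in> S"
    by (rule mem_eqI[OF diff[OF Y E01]]) auto
  have E02: "E 0 2 \<in> S"
    using comm_unit[OF E01 E12] n by simp
  have E10: "E 1 0 \<in> S"
    using comm_unit[OF E12 E20] n by simp
  show ?thesis
  proof (rule sl_subset_if_hub[OF _ _ _ A])
    fix j assume j: "0 < j" "j < n"
    then have "j = 1 \<or> j = 2"
      using n by linarith
    then show "E 0 j \<in> S" "E j 0 \<in> S"
      using E01 E02 E10 E20 by auto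
  qed (use lt in simp)
qed

text \<open>The part of the Jordan block \<open>Y\<close> on which \<open>h = E 1 1 + E 2 2\<close> acts as the identity is
  \<open>P = E 0 1 + E 2 3\<close>, and \<open>h\<close> annihilates the remainder \<open>R\<close>. Here \<open>n \<ge> 5\<close> is needed for the diagonal
  element \<open>E 0 0 + E 1 1 + E 2 2 + E 3 3\<close> to act nontrivially, which is how the first unit above
  the diagonal, \<open>E 3 4\<close>, is found.\<close>

lemma generators_char_2:
  assumes two: "(2::'a) = 0" and n: "n \<ge> 5"
    and X: "E 1 1 + E 2 2 + E (n - 1) 0 \<in> S" and Y: "shift_mat n 0 \<in> S"
    and A: "A \<in> carrier_mat n n" "mat_trace A = 0"
  shows "A \<in> S"
proof -
  have plus_self: "x + x = 0" for x :: 'a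
    using two by (metis mult_2 mult_zero_left)
  have uminus_self: "- x = x" for x :: 'a
    by (rule minus_unique[OF plus_self])
  have minus: "x - y = x + y" for x y :: 'a
    by (simp only: diff_conv_add_uminus uminus_self)
  have plus_plus: "x + (x + y) = y" for x y :: 'a
    by (simp add: plus_self flip: add.assoc)
  note char_2 = uminus_self minus plus_self plus_plus two add.left_commute add.commute
  define m where "m = n - 1"
  have m: "m < n" "4 \<le> m" "Suc m = n"
    using n by (auto simp: m_def)
  have X: "E 1 1 + E 2 2 + E m 0 \<in> S"
    using X by (simp add: m_def)
  define P where "P = E 0 1 + E 2 3"
  define R where "R = E 1 2 + shift_mat n 3"
  have XY: "E 0 1 + E 2 3 + E m 1 + E (m - 1) 0 \<in> S"
    by (rule mem_eqI[OF comm[OF X Y]])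
      (use m in \<open>simp_all add: comm_simps char_2\<close>)
  have P: "P \<in> S"
    by (rule mem_eqI[OF comm[OF X XY]])
      (use m in \<open>simp_all add: comm_simps char_2 P_def\<close>)
  have R: "R \<in> S"
    by (rule mem_eqI[OF diff[OF Y P]])
      (use m in \<open>auto simp: two P_def R_def split: split_of_bool\<close>)
  have Em1: "E m 1 \<in> S"
    by (rule mem_eqI[OF diff[OF comm[OF X P] P]])
      (use m in \<open>simp_all add: comm_simps char_2 P_def\<close>)
  have "E (m - 1) 0 \<in> S"
    by (rule mem_eqI[OF comm[OF X R]])
      (use m in \<open>simp_all add: comm_simps char_2 R_def\<close>)
  then have column: "E i 0 \<in> S" if "3 \<le> i" "i < m" for i
    by (rule column_segment[OF _ R])
      (use that m in \<open>auto simp: comm_simps char_2 R_def intro!: eq_matI\<close>)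
  have "E 2 0 + E 3 1 \<in> S"
    by (rule mem_eqI[OF comm[OF P column[of 3]]])
      (use m in \<open>simp_all add: comm_simps char_2 P_def\<close>)
  from comm[OF this R] have 10: "E 1 0 + E 3 2 \<in> S"
    by (rule mem_eqI) (use m in \<open>simp_all add: comm_simps char_2 R_def\<close>)
  have "E 0 0 + E 1 1 + E 2 2 + E 3 3 \<in> S"
    by (rule mem_eqI[OF comm[OF P 10]])
      (use m in \<open>simp_all add: comm_simps char_2 P_def\<close>)
  from comm[OF this R] have E34: "E 3 4 \<in> S"
    by (rule mem_eqI) (use m in \<open>simp_all add: comm_simps char_2 R_def\<close>)
  have row3: "E 3 j \<in> S" if "4 \<le> j" "j < n" for j
    by (rule row_segment[OF E34 R _ that])
      (use m in \<open>auto simp: comm_simps char_2 R_def intro!: eq_matI\<close>)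
  have row2: "E 2 j \<in> S" if "4 \<le> j" "j < n" for j
    by (rule mem_eqI[OF comm[OF P row3[of j]]])
      (use that m in \<open>simp_all add: comm_simps char_2 P_def\<close>)
  \<comment> \<open>The purpose of \<open>E 2 1\<close> is to recover \<open>h\<close> and thereby \<open>E m 0 = X - h\<close>.\<close>
  have "E 2 1 \<in> S"
    using comm_unit[OF row2[of m] Em1] m by simp
  from comm[OF this R] have "E 1 1 + E 2 2 \<in> S"
    by (rule mem_eqI) (use m in \<open>simp_all add: comm_simps char_2 R_def\<close>)
  from diff[OF X this] have Em0: "E m 0 \<in> S"
    by (rule mem_eqI) (use m in \<open>simp_all add: char_2\<close>)
  have column: "E i 0 \<in> S" if "3 \<le> i" "i < n" for i
    using column[of i] Em0 that m by (cases "i = m") auto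
  have E20: "E 2 0 \<in> S"
    using comm_unit[OF row2[of 4] column[of 4]] m by simp
  have E31: "E 3 1 \<in> S"
    by (rule mem_eqI[OF diff[OF \<open>E 2 0 + E 3 1 \<in> S\<close> E20]]) (use m in simp_all)
  have E32: "E 3 2 \<in> S"
    by (rule mem_eqI[OF comm[OF E31 R]])
      (use m in \<open>simp_all add: comm_simps char_2 R_def\<close>)
  have E10: "E 1 0 \<in> S"
    by (rule mem_eqI[OF diff[OF 10 E32]]) (use m in simp_all)
  have E41: "E 4 1 \<in> S"
    by (rule mem_eqI[OF comm[OF P column[of 4]]])
      (use m in \<open>simp_all add: comm_simps char_2 P_def\<close>)
  have E42: "E 4 2 \<in> S"
    by (rule mem_eqI[OF add[OF comm[OF E41 R] E31]])
      (use m in \<open>simp_all add: comm_simps char_2 R_def\<close>)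
  have E43: "E 4 3 \<in> S"
    by (rule mem_eqI[OF comm[OF P E42]])
      (use m in \<open>simp_all add: comm_simps char_2 P_def\<close>)
  \<comment> \<open>Eigenvalue \<open>0\<close> on \<open>E 0 1\<close> and \<open>1\<close> on \<open>E 2 3\<close>; so \<open>P\<close> splits.\<close>
  have "E 3 3 + E 4 4 \<in> S"
    by (rule mem_eqI[OF comm[OF E34 E43]])
      (use m in \<open>simp_all add: comm_simps char_2\<close>)
  from comm[OF this P] have E23: "E 2 3 \<in> S"
    by (rule mem_eqI) (use m in \<open>simp_all add: comm_simps char_2 P_def\<close>)
  have E01: "E 0 1 \<in> S"
    by (rule mem_eqI[OF diff[OF P E23]]) (use m in \<open>simp_all add: P_def\<close>)
  have "E 0 0 + E 1 1 \<in> S"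
    by (rule mem_eqI[OF comm[OF E01 E10]])
      (use m in \<open>simp_all add: comm_simps char_2\<close>)
  from comm[OF this R] have E12: "E 1 2 \<in> S"
    by (rule mem_eqI) (use m in \<open>simp_all add: comm_simps char_2 R_def\<close>)
  have E02: "E 0 2 \<in> S"
    using comm_unit[OF E01 E12] m by simp
  have E03: "E 0 3 \<in> S"
    using comm_unit[OF E02 E23] m by simp
  show ?thesis
  proof (rule sl_subset_if_hub[OF _ _ _ A])
    fix j assume j: "0 < j" "j < n"
    then consider "j = 1" | "j = 2" | "j = 3" | "4 \<le> j"
      by linarith
    then show "E 0 j \<in> S"
      using E01 E02 E03 comm_unit[OF E03 row3[of j]] m j by cases auto
    consider "j = 1" | "j = 2" | "3 \<le> j"
      using j by linarith
    then show "E j 0 \<in> S"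
      using E10 E20 column j by cases auto
  qed (use m in simp)
qed

end

section \<open>Two generators for the special linear Lie algebra\<close>

lemma mat_trace_unit: "i < n \<Longrightarrow> mat_trace (unit_mat n i j) = of_bool (i = j)"
  by (simp add: mat_trace_def of_bool_def)

lemma mat_trace_shift: "mat_trace (shift_mat n c) = 0"
  by (simp add: mat_trace_def)

lemma two_generated_slI:
  fixes X Y :: "'a::field mat"
  assumes XY: "X \<in> carrier_mat n n" "Y \<in> carrier_mat n n" "mat_trace X = 0" "mat_trace Y = 0"
    and gen: "\<And>S A. \<lbrakk>matrix_lie_algebra n S; X \<in> S; Y \<in> S; A \<in> carrier_mat n n; mat_trace A = 0\<rbrakk>
      \<Longrightarrow> A \<in> S"
  shows "k_generated 2 (class_ring :: 'a ring) (sl TYPE('a) n)"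
proof -
  let ?L = "sl TYPE('a) n"
  have "carrier ?L \<subseteq> S" if S: "lie_subalgebra class_ring S ?L" "{X, Y} \<subseteq> S" for S
  proof -
    have sub: "submodule class_ring S ?L"
      using S(1) by (simp add: lie_subalgebra_def subspace_def)
    have "matrix_lie_algebra n S"
    proof
      show "S \<subseteq> carrier_mat n n"
        using submodule.subset[OF sub] by (auto simp: sl_simps)
      show "0\<^sub>m n n \<in> S"
        using submodule.zero_closed[OF sub] by (simp add: sl_simps)
      show "A + B \<in> S" if "A \<in> S" "B \<in> S" for A B
        using submodule.m_closed[OF sub that] by (simp add: sl_simps)
      show "c \<cdot>\<^sub>m A \<in> S" if "A \<in> S" for c A
        using submodule.smult_closed[OF sub _ that] by (simp add: sl_simps)
      show "comm A B \<in> S" if "A \<in> S" "B \<in> S" for A B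
        using S(1) that by (simp add: lie_subalgebra_def sl_simps comm_def)
    qed
    then show ?thesis
      using gen S(2) by (auto simp: sl_simps)
  qed
  moreover have "{X, Y} \<subseteq> carrier ?L"
    using XY by (simp add: sl_simps)
  ultimately have "lie_generated class_ring ?L {X, Y} = carrier ?L"
    unfolding lie_generated_def
    using lie_algebra.carrier_lie_subalgebra[OF lie_algebra_sl]
    by (intro equalityI Inter_lower Inter_greatest) auto
  then show ?thesis
    unfolding k_generated_def using \<open>{X, Y} \<subseteq> carrier ?L\<close> by (intro exI[of _ "[X, Y]"]) simp
qed

text \<open>The pairs \<open>(3, 3)\<close> and \<open>(4, 2)\<close> of size and characteristic are the only ones that the
  constructions leave open.\<close>

lemma two_generated_sl:
  assumes "n > 0" and "n = 3 \<Longrightarrow> (3::'a::field) \<noteq> 0" and "n = 4 \<Longrightarrow> (2::'a) \<noteq> 0"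
  shows "k_generated 2 (class_ring :: 'a ring) (sl TYPE('a) n)"
proof -
  note trace = mat_trace_simps(1,2)[of _ n] mat_trace_unit mat_trace_shift minus_carrier_mat
  consider "n = 1" | "n = 2" | "n = 3" | "n \<ge> 4" "(2::'a) \<noteq> 0" | "n \<ge> 5" "(2::'a) = 0"
    using assms(1,3) by linarith
  then show ?thesis
  proof cases
    case 1
    show ?thesis
      by (rule two_generated_slI[of "0\<^sub>m n n" _ "0\<^sub>m n n"],
          simp_all add: mat_trace_zero, rule matrix_lie_algebra.sl_subset_if_hub)
        (use 1 in simp_all)
  next
    case 2
    show ?thesis
    proof (rule two_generated_slI[of "unit_mat n 0 1" _ "unit_mat n 1 0"])
      fix S :: "'a mat set" and A :: "'a mat"
      assume S: "matrix_lie_algebra n S" "unit_mat n 0 1 \<in> S" "unit_mat n 1 0 \<in> S"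
        and A: "A \<in> carrier_mat n n" "mat_trace A = 0"
      have one: "j = 1" if "0 < j" "j < n" for j :: nat
        using that 2 by simp
      show "A \<in> S"
        by (rule matrix_lie_algebra.sl_subset_if_hub[OF S(1) _ _ assms(1) A])
          (use S(2,3) one in auto)
    qed (use 2 in \<open>simp_all add: trace\<close>)
  next
    case 3
    show ?thesis
      by (rule two_generated_slI[OF _ _ _ _ matrix_lie_algebra.generators_3[OF _ assms(2)[OF 3] 3]])
        (use 3 in \<open>simp_all add: trace\<close>)
  next
    case 4
    show ?thesis
      by (rule two_generated_slI[OF _ _ _ _ matrix_lie_algebra.generators_odd[OF _ 4(2,1)]])
        (use 4 in \<open>simp_all add: trace\<close>)
  next
    case 5
    show ?thesis
      by (rule two_generated_slI[OF _ _ _ _ matrix_lie_algebra.generators_char_2[OF _ 5(2,1)]])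
        (use 5 in \<open>simp_all add: trace\<close>)
  qed
qed

lemma CHAR_eq_if_prime_eq_0:
  assumes "prime q" "of_nat q = (0::'a::field)"
  shows "CHAR('a) = q"
proof -
  have "CHAR('a) dvd q"
    using assms(2) by (simp add: of_nat_eq_0_iff_char_dvd)
  moreover have "CHAR('a) \<noteq> 1"
    using of_nat_CHAR[where 'a = 'a] by (metis of_nat_1 one_neq_zero)
  ultimately show ?thesis
    using assms(1) by (metis prime_nat_iff)
qed

theorem mainTheorem1:
  fixes n p :: nat
  assumes "p = CHAR('a::{field, finite})"
    and "n > 0"
    and "(n, p) \<noteq> (3, 3)"
    and "(n, p) \<noteq> (4, 2)"
  shows "k_generated 2 (class_ring :: 'a ring) (psl TYPE('a) n)"
proof -
  have "(3::'a) \<noteq> 0" if "n = 3"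
    using CHAR_eq_if_prime_eq_0[of 3, where 'a = 'a] assms(1,3) that by auto
  moreover have "(2::'a) \<noteq> 0" if "n = 4"
    using CHAR_eq_if_prime_eq_0[of 2, where 'a = 'a] assms(1,4) that by auto
  ultimately show ?thesis
    unfolding psl_def using assms(2)
    by (intro lie_algebra.k_generated_quotient[OF lie_algebra_sl lie_ideal_scalar_mats] two_generated_sl)
qed

end
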